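(* Let $G=(E_1,\sim,\sigma_1)$ be a graph in which every vertex has degree at least three. Let $\sigma_0=\prod_{v\in V}\sigma_v$ be a fat graph structure on $G$ such that there is a vertex $v$ which is common to $b$ boundary components of $(G,\sigma_0)$, where $b\ge 3$. Then there exists a fat graph structure $\sigma_0'$ on $G$ such that $$\#\partial(G,\sigma_0')=\#\partial(G,\sigma_0)-2 .$$
   Context: A finite graph is a triple $G=(E_1,\sim,\sigma_1)$, where $E_1$ is a finite non-empty set with an even number of elements (the directed edges), $\sigma_1$ is a fixed-point-free involution on $E_1$ (reversal of direction), and $\sim$ is an equivalence relation on $E_1$. The undirected edges are the orbits of $\sigma_1$; the vertices are the equivalence classes, $V=E_1/\!\sim$; a directed edge emanates from the vertex that is its class; the degree of $v\in V$ is $|v|$. All graphs are assumed connected. A fat graph structure on $G$ is a permutation $\sigma_0$ of $E_1$ whose cycles are exactly cyclic orders on the vertices: $\sigma_0=\prod_{v\in V}\sigma_v$, where $\sigma_v$ is a cyclic permutation of all the directed edges emanating from $v$ (a $\deg(v)$-cycle on the set $v$). The boundary components of the fat graph $(G,\sigma_0)$ are the cycles (orbits on $E_1$) of the permutation $\sigma_1\circ\sigma_0^{-1}$ (apply $\sigma_0^{-1}$ first); they correspond to the boundary components of the oriented surface obtained by thickening $G$ according to $\sigma_0$. Their number is denoted $\#\partial(G,\sigma_0)$. A vertex $v$ is common to (shared by) $b$ boundary components if the directed edges emanating from $v$ lie in exactly $b$ distinct such orbits. *)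

theory Defs
  imports "HOL-Combinatorics.Combinatorics"
begin

text \<open>
  A graph is given by its finite set \<open>E\<close> of directed edges, the equivalence relation \<open>R\<close> on \<open>E\<close>
  (emanating from the same vertex) and the fixed-point-free involution \<open>\<sigma>\<^sub>1\<close> reversing directions.
  Permutations of \<open>E\<close> are total functions that are the identity outside \<open>E\<close>.
\<close>

locale finite_graph =
  fixes E :: "'a set" and R :: "('a \<times> 'a) set" and \<sigma>\<^sub>1 :: "'a \<Rightarrow> 'a"
  assumes finite_edges: "finite E"
    and nonempty_edges: "E \<noteq> {}"
    and even_edges: "even (card E)"
    and equiv_edges: "equiv E R"
    and reversal_permutes: "\<sigma>\<^sub>1 permutes E"
    and reversal_involution: "\<And>e. e \<in> E \<Longrightarrow> \<sigma>\<^sub>1 (\<sigma>\<^sub>1 e) = e"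
    and reversal_no_fixpoint: "\<And>e. e \<in> E \<Longrightarrow> \<sigma>\<^sub>1 e \<noteq> e"

text \<open>
  Connectedness, on directed edges: any two of them are linked by a sequence of steps, each passing
  to a directed edge at the same vertex or to the reversed edge.
\<close>

locale connected_finite_graph = finite_graph +
  assumes connected_edges:
    "\<And>e e'. e \<in> E \<Longrightarrow> e' \<in> E \<Longrightarrow> (e, e') \<in> (R \<union> {(d, \<sigma>\<^sub>1 d) |d. d \<in> E})\<^sup>*"

definition vertices :: "'a set \<Rightarrow> ('a \<times> 'a) set \<Rightarrow> 'a set set" where
  "vertices E R = E // R"

definition degree :: "'a set \<Rightarrow> nat" where
  "degree v = card v"

text \<open>
  \<open>cyclic_on \<sigma>\<^sub>0 v\<close> says that \<open>\<sigma>\<^sub>0\<close> restricts to a single \<open>degree v\<close>-cycle \<open>\<sigma>\<^sub>v\<close> on all of \<open>v\<close>. As the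
  vertices partition \<open>E\<close>, this means that \<open>\<sigma>\<^sub>0\<close> is the product of the disjoint cycles \<open>\<sigma>\<^sub>v\<close>.
\<close>

definition fat_graph_structure :: "'a set \<Rightarrow> ('a \<times> 'a) set \<Rightarrow> ('a \<Rightarrow> 'a) \<Rightarrow> bool" where
  "fat_graph_structure E R \<sigma>\<^sub>0 \<longleftrightarrow>
     \<sigma>\<^sub>0 permutes E \<and> (\<forall>v \<in> vertices E R. cyclic_on \<sigma>\<^sub>0 v)"

definition boundary_components :: "'a set \<Rightarrow> ('a \<Rightarrow> 'a) \<Rightarrow> ('a \<Rightarrow> 'a) \<Rightarrow> 'a set set" where
  "boundary_components E \<sigma>\<^sub>1 \<sigma>\<^sub>0 = orbit (\<sigma>\<^sub>1 \<circ> inv \<sigma>\<^sub>0) ` E"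

definition num_boundary :: "'a set \<Rightarrow> ('a \<Rightarrow> 'a) \<Rightarrow> ('a \<Rightarrow> 'a) \<Rightarrow> nat" where
  "num_boundary E \<sigma>\<^sub>1 \<sigma>\<^sub>0 = card (boundary_components E \<sigma>\<^sub>1 \<sigma>\<^sub>0)"

definition common_to_boundaries ::
  "'a set \<Rightarrow> ('a \<Rightarrow> 'a) \<Rightarrow> ('a \<Rightarrow> 'a) \<Rightarrow> 'a set \<Rightarrow> nat \<Rightarrow> bool" where
  "common_to_boundaries E \<sigma>\<^sub>1 \<sigma>\<^sub>0 v b \<longleftrightarrow>
     card {B \<in> boundary_components E \<sigma>\<^sub>1 \<sigma>\<^sub>0. B \<inter> v \<noteq> {}} = b"

end

theory Submission
  imports Defs
begin

text \<open>
  Write \<open>\<phi> = \<sigma>\<^sub>1 \<circ> inv \<sigma>\<^sub>0\<close> and choose \<open>x, y, z \<in> v\<close> in three distinct orbits of \<open>\<phi>\<close>. Composing a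
  permutation with the transposition of two points merges their orbits if these differ and splits
  their orbit otherwise. Hence \<open>inv \<sigma>\<^sub>0 \<circ> (x y)\<close> splits \<open>v\<close> into an orbit of \<open>x\<close> and an orbit of
  \<open>y\<close>. Let \<open>w\<close> be the one of \<open>x, y\<close> whose orbit misses \<open>z\<close>: then \<open>inv \<sigma>\<^sub>0 \<circ> (x y) \<circ> (z w)\<close> is again
  a single cycle on \<open>v\<close>. For \<open>\<phi>\<close>, both transpositions merge two orbits, so two boundary
  components are lost.
\<close>

section \<open>Orbits of a permutation composed with a transposition\<close>

lemma orbit_subset_closed:
  assumes "a \<in> A" and "\<And>u. u \<in> A \<Longrightarrow> f u \<in> A"
  shows "orbit f a \<subseteq> A"
proof
  fix u assume "u \<in> orbit f a"
  then show "u \<in> A" by induction (use assms in auto)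
qed

lemma permutation_orbit_eq:
  assumes "permutation f" "b \<in> orbit f a"
  shows "orbit f b = orbit f a"
  using assms by (blast intro: orbit_trans orbit_swap permutation_self_in_orbit)

text \<open>The composed map sends \<open>a\<close> to \<open>f b\<close> and agrees with
  \<open>f\<close> away from \<open>a\<close> and \<open>b\<close>. Its path from \<open>a\<close>
  therefore follows \<open>f\<close> through the orbit of \<open>b\<close>, which never meets
  \<open>a\<close>.\<close>

lemma orbit_subset_orbit_comp_transpose:
  assumes "a \<notin> orbit f b"
  shows "orbit f b \<subseteq> orbit (f \<circ> transpose a b) a"
proof
  let ?g = "f \<circ> transpose a b"
  have ga: "f b \<in> orbit ?g a"
    by (rule orbit_eqI(1)) simp
  fix u assume "u \<in> orbit f b"
  then show "u \<in> orbit ?g a"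
  proof induction
    case base
    show ?case by (rule ga)
  next
    case (step u)
    show ?case
    proof (cases "u = b")
      case True
      then show ?thesis using ga by (simp only:)
    next
      case False
      moreover have "u \<noteq> a" using step.hyps assms by auto
      ultimately have "f u = ?g u" by (simp add: transpose_apply_other)
      then show ?thesis using step.IH by (rule orbit_eqI(2))
    qed
  qed
qed

text \<open>The preceding inclusion, used with \<open>a\<close> and \<open>b\<close> in both roles,
  puts both orbits inside the new one, since \<open>b\<close> is reached from \<open>a\<close>.
  Conversely, the union is closed under the new map, which only exchanges the images of
  \<open>a\<close> and \<open>b\<close>.\<close>

lemma orbit_comp_transpose_merge:
  assumes "permutation f" and "b \<notin> orbit f a"
  shows "orbit (f \<circ> transpose a b) a = orbit f a \<union> orbit f b"
proof
  let ?g = "f \<circ> transpose a b"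
  have ab: "a \<notin> orbit f b"
    using assms orbit_swap permutation_self_in_orbit by metis
  have b: "orbit f b \<subseteq> orbit ?g a"
    using ab by (rule orbit_subset_orbit_comp_transpose)
  have "orbit f a \<subseteq> orbit ?g b"
    using orbit_subset_orbit_comp_transpose[OF assms(2)] by (simp add: transpose_commute)
  moreover have "orbit ?g b \<subseteq> orbit ?g a"
    using b permutation_self_in_orbit[OF assms(1)] by (meson orbit_trans subset_iff)
  ultimately show "orbit f a \<union> orbit f b \<subseteq> orbit ?g a"
    using b by blast
  show "orbit ?g a \<subseteq> orbit f a \<union> orbit f b"
  proof (rule orbit_subset_closed)
    show "a \<in> orbit f a \<union> orbit f b"
      using permutation_self_in_orbit[OF assms(1)] by blast
    show "?g u \<in> orbit f a \<union> orbit f b" if "u \<in> orbit f a \<union> orbit f b" for u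
      using that by (auto simp: transpose_def intro: orbit.intros)
  qed
qed

lemma orbit_comp_transpose_other:
  assumes "permutation f" and "c \<notin> orbit f a" and "c \<notin> orbit f b"
  shows "orbit (f \<circ> transpose a b) c = orbit f c"
proof (rule orbit_cong)
  show "c \<in> orbit f c"
    using assms(1) by (rule permutation_self_in_orbit)
  fix s assume "s \<in> orbit f c"
  then have "s \<noteq> a" "s \<noteq> b"
    using assms permutation_orbit_eq permutation_self_in_orbit by metis+
  then show "(f \<circ> transpose a b) s = f s"
    by (simp add: transpose_apply_other)
qed

lemma card_orbits_comp_transpose_merge:
  assumes "finite S" "f permutes S" "a \<in> S" "b \<in> S" "b \<notin> orbit f a"
  shows "Suc (card (orbit (f \<circ> transpose a b) ` S)) = card (orbit f ` S)"
proof -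
  let ?g = "f \<circ> transpose a b"
  have f: "permutation f"
    using assms permutation_permutes by blast
  have g: "permutation ?g"
    by (intro permutation_compose f permutation_swap_id)
  have self: "c \<in> orbit f c" for c
    using f by (rule permutation_self_in_orbit)
  let ?U = "orbit f a \<union> orbit f b"
  have U: "orbit ?g c = ?U" if "c \<in> ?U" for c
    using permutation_orbit_eq[OF g] orbit_comp_transpose_merge[OF f assms(5)] that by metis
  have V: "orbit ?g c = orbit f c" if "c \<notin> ?U" for c
    using that by (intro orbit_comp_transpose_other f) auto
  let ?C = "orbit f ` (S - ?U)"
  \<comment> \<open>Listing \<open>a\<close> and \<open>b\<close> separately makes the merged part
    visibly nonempty, so that its image is exactly one orbit.\<close>
  have "S = {a, b} \<union> (S \<inter> ?U) \<union> (S - ?U)"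
    using assms by blast
  then have "orbit ?g ` S = orbit ?g ` ({a, b} \<union> (S \<inter> ?U)) \<union> orbit ?g ` (S - ?U)"
    by (metis image_Un)
  also have "orbit ?g ` ({a, b} \<union> (S \<inter> ?U)) = {?U}"
    using U self by auto
  also have "orbit ?g ` (S - ?U) = ?C"
    using V by (auto intro!: image_cong)
  finally have 1: "orbit ?g ` S = {?U} \<union> ?C" .
  have 2: "orbit f ` S = insert (orbit f a) (insert (orbit f b) ?C)"
    using assms permutation_orbit_eq[OF f] by auto
  have "?U \<notin> ?C" "orbit f a \<notin> ?C" "orbit f b \<notin> ?C" "orbit f a \<noteq> orbit f b"
    using self assms(5) by blast+
  then show ?thesis
    unfolding 1 2 using assms(1) by simp
qed

text \<open>If \<open>m\<close> is the least positive exponent taking \<open>x\<close> to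
  \<open>y\<close>, the arc from \<open>f x\<close> to \<open>y\<close> avoids \<open>x\<close>. The
  composed map sends \<open>y\<close> back to \<open>f x\<close>, so this arc is closed and contains
  the new orbit of \<open>y\<close>.\<close>

lemma orbit_comp_transpose_split:
  assumes "y \<in> orbit f x" and "x \<noteq> y"
  shows "x \<notin> orbit (f \<circ> transpose x y) y"
proof -
  let ?g = "f \<circ> transpose x y"
  define m where "m = funpow_dist1 f x y"
  have m: "(f ^^ m) x = y"
    using assms(1) unfolding m_def by (rule funpow_dist1_prop)
  have "0 < m" by (simp add: m_def)
  have least: "(f ^^ i) x \<noteq> y" if "0 < i" "i < m" for i
    using that unfolding m_def by (rule funpow_dist1_least)
  \<comment> \<open>A return to \<open>x\<close> at a step \<open>i < m\<close> would leave only
    \<open>m - i\<close> steps to \<open>y\<close>, against the minimality of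
    \<open>m\<close>.\<close>
  have nx: "(f ^^ i) x \<noteq> x" if "0 < i" "i \<le> m" for i
  proof
    assume i: "(f ^^ i) x = x"
    with m assms(2) that have "i < m" by (cases "i = m") auto
    have "(f ^^ (m - i)) x = (f ^^ (m - i)) ((f ^^ i) x)"
      using i by simp
    also have "\<dots> = (f ^^ (m - i + i)) x"
      by (simp only: funpow_add comp_apply)
    finally have "(f ^^ (m - i)) x = y"
      using \<open>i < m\<close> m by simp
    with least[of "m - i"] \<open>i < m\<close> that show False by simp
  qed
  let ?A = "(\<lambda>i. (f ^^ i) x) ` {1..m}"
  have "orbit ?g y \<subseteq> ?A"
  proof (rule orbit_subset_closed)
    show "y \<in> ?A" using m \<open>0 < m\<close> by force
    fix u assume "u \<in> ?A"
    then obtain i where i: "1 \<le> i" "i \<le> m" "u = (f ^^ i) x" by auto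
    show "?g u \<in> ?A"
    proof (cases "i = m")
      case True
      then have "?g u = (f ^^ 1) x" using i m by simp
      then show ?thesis using \<open>0 < m\<close> by (intro image_eqI[where x = 1]) auto
    next
      case False
      then have "u \<noteq> x" "u \<noteq> y" using i nx[of i] least[of i] by auto
      then have "?g u = (f ^^ Suc i) x" using i by (simp add: transpose_apply_other)
      then show ?thesis using i False by (intro image_eqI[where x = "Suc i"]) auto
    qed
  qed
  moreover have "?A \<subseteq> - {x}"
    using nx by (intro image_subsetI) auto
  ultimately show ?thesis by blast
qed

section \<open>Two transpositions: one cycle on the vertex, two orbits fewer in total\<close>

lemma cyclic_on_comp_two_transposes:
  assumes "permutation f" "cyclic_on f v" "x \<in> v" "y \<in> v" "z \<in> v" "x \<noteq> y"
  obtains w where "w \<in> {x, y}" "cyclic_on (f \<circ> transpose x y \<circ> transpose z w) v"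
proof -
  let ?g = "f \<circ> transpose x y"
  have g: "permutation ?g"
    by (intro permutation_compose assms(1) permutation_swap_id)
  have self: "c \<in> orbit ?g c" for c
    using g by (rule permutation_self_in_orbit)
  have v: "v = orbit f x"
    using assms orbit_cyclic_eq3 by metis
  have split: "x \<notin> orbit ?g y"
    using assms v by (intro orbit_comp_transpose_split) auto
  have cover: "orbit ?g x \<union> orbit ?g y = v"
  proof
    show "orbit ?g x \<union> orbit ?g y \<subseteq> v"
      using assms cyclic_on_inI[OF assms(2)]
      by (intro Un_least orbit_subset_closed) (auto simp: transpose_def)
    have "f u \<in> orbit ?g x \<union> orbit ?g y" if "u \<in> orbit ?g x \<union> orbit ?g y" for u
    proof -
      \<comment> \<open>The last two cases are \<open>f y = ?g x\<close> and
        \<open>f x = ?g y\<close>.\<close>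
      have "f u = ?g u \<or> f u = ?g x \<or> f u = ?g y"
        by (auto simp: transpose_def)
      then show ?thesis
        using that orbit.base[of ?g] orbit.step[of _ ?g] by (metis Un_iff)
    qed
    then show "v \<subseteq> orbit ?g x \<union> orbit ?g y"
      unfolding v by (intro orbit_subset_closed) (use self in auto)
  qed
  \<comment> \<open>Which of the two arcs contains \<open>z\<close> depends on the cyclic order, so
    \<open>w\<close> is chosen by cases as the representative of the other arc.\<close>
  have "\<exists>w \<in> {x, y}. w \<notin> orbit ?g z \<and> orbit ?g z \<union> orbit ?g w = v"
  proof (cases "z \<in> orbit ?g y")
    case True
    then show ?thesis
      using permutation_orbit_eq[OF g True] split cover by (intro bexI[of _ x]) auto
  next
    case False
    then have "orbit ?g z = orbit ?g x"
      using cover assms permutation_orbit_eq[OF g] by blast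
    moreover have "y \<notin> orbit ?g x"
      using split self permutation_orbit_eq[OF g] by metis
    ultimately show ?thesis
      using cover by auto
  qed
  then obtain w where w: "w \<in> {x, y}" "w \<notin> orbit ?g z" "orbit ?g z \<union> orbit ?g w = v"
    by blast
  have "cyclic_on (?g \<circ> transpose z w) v"
    using orbit_comp_transpose_merge[OF g w(2)] w(3) assms(5)
    by (intro cyclic_on_singleI[of z]) auto
  with w(1) that show thesis by blast
qed

text \<open>Merging the orbits of \<open>x\<close> and \<open>y\<close> leaves that of
  \<open>z\<close> unchanged, so \<open>w\<close> stays outside it and the second merge applies,
  whichever of \<open>x\<close> and \<open>y\<close> it is.\<close>

lemma card_orbits_comp_two_transposes:
  assumes "finite S" "f permutes S" "x \<in> S" "y \<in> S" "z \<in> S"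
    and "y \<notin> orbit f x" "z \<notin> orbit f x" "z \<notin> orbit f y" "w \<in> {x, y}"
  shows "card (orbit (f \<circ> transpose x y \<circ> transpose z w) ` S) + 2 = card (orbit f ` S)"
proof -
  let ?g = "f \<circ> transpose x y"
  have f: "permutation f"
    using assms permutation_permutes by blast
  have g: "?g permutes S"
    using assms by (intro permutes_compose permutes_swap_id)
  have "orbit ?g z = orbit f z"
    using assms by (intro orbit_comp_transpose_other f)
  moreover have "w \<notin> orbit f z"
    using assms permutation_orbit_eq[OF f] permutation_self_in_orbit[OF f] by (metis insertE singletonD)
  ultimately have "Suc (card (orbit (?g \<circ> transpose z w) ` S)) = card (orbit ?g ` S)"
    using assms g by (intro card_orbits_comp_transpose_merge) auto
  moreover have "Suc (card (orbit ?g ` S)) = card (orbit f ` S)"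
    using assms by (intro card_orbits_comp_transpose_merge)
  ultimately show ?thesis by simp
qed

section \<open>The modified fat graph structure\<close>

theorem proposition1p7:
  fixes E :: "'a set" and R :: "('a \<times> 'a) set" and \<sigma>\<^sub>1 \<sigma>\<^sub>0 :: "'a \<Rightarrow> 'a"
    and v :: "'a set" and b :: nat
  assumes "connected_finite_graph E R \<sigma>\<^sub>1"
    and "\<forall>w \<in> vertices E R. degree w \<ge> 3"
    and "fat_graph_structure E R \<sigma>\<^sub>0"
    and "v \<in> vertices E R"
    and "common_to_boundaries E \<sigma>\<^sub>1 \<sigma>\<^sub>0 v b"
    and "b \<ge> 3"
  shows "\<exists>\<sigma>\<^sub>0'. fat_graph_structure E R \<sigma>\<^sub>0' \<and>
           int (num_boundary E \<sigma>\<^sub>1 \<sigma>\<^sub>0') = int (num_boundary E \<sigma>\<^sub>1 \<sigma>\<^sub>0) - 2"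
proof -
  interpret connected_finite_graph E R \<sigma>\<^sub>1 by fact
  have perm: "\<sigma>\<^sub>0 permutes E" and cyc: "\<And>w. w \<in> vertices E R \<Longrightarrow> cyclic_on \<sigma>\<^sub>0 w"
    using assms(3) unfolding fat_graph_structure_def by auto
  have "v \<subseteq> E"
    using assms(4) equiv_edges unfolding vertices_def by (simp add: in_quotient_imp_subset)
  let ?\<phi> = "\<sigma>\<^sub>1 \<circ> inv \<sigma>\<^sub>0"
  have \<phi>: "?\<phi> permutes E"
    using perm reversal_permutes by (intro permutes_compose permutes_inv)
  then have permutation_\<phi>: "permutation ?\<phi>"
    using finite_edges permutation_permutes by blast
  obtain \<B> where \<B>: "\<B> \<subseteq> {B \<in> boundary_components E \<sigma>\<^sub>1 \<sigma>\<^sub>0. B \<inter> v \<noteq> {}}" "card \<B> = 3"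
    using assms(5,6) obtain_subset_with_card_n unfolding common_to_boundaries_def by metis
  then obtain X Y Z where XYZ: "\<B> = {X, Y, Z}" "X \<noteq> Y" "X \<noteq> Z" "Y \<noteq> Z"
    by (auto simp: card_3_iff)
  have orb: "B = orbit ?\<phi> e" if "B \<in> \<B>" "e \<in> B" for B e
    using that \<B>(1) permutation_orbit_eq[OF permutation_\<phi>]
    unfolding boundary_components_def by blast
  obtain x y z where x: "x \<in> X" "x \<in> v" and y: "y \<in> Y" "y \<in> v" and z: "z \<in> Z" "z \<in> v"
    using \<B>(1) XYZ(1) by auto
  have distinct: "y \<notin> orbit ?\<phi> x" "z \<notin> orbit ?\<phi> x" "z \<notin> orbit ?\<phi> y"
    using orb x y z XYZ by (metis insertCI)+
  then have "x \<noteq> y"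
    using permutation_self_in_orbit[OF permutation_\<phi>] by metis
  have perm0: "permutation \<sigma>\<^sub>0"
    using perm finite_edges permutation_permutes by blast
  have cyc_inv: "cyclic_on (inv \<sigma>\<^sub>0) w" if "w \<in> vertices E R" for w
    using cyc[OF that] unfolding cyclic_on_def by (simp add: orbit_inv_eq[OF perm0])
  obtain w where w: "w \<in> {x, y}"
    and cyc_v: "cyclic_on (inv \<sigma>\<^sub>0 \<circ> transpose x y \<circ> transpose z w) v"
    using cyclic_on_comp_two_transposes[OF permutation_inverse[OF perm0] cyc_inv[OF assms(4)]
        x(2) y(2) z(2) \<open>x \<noteq> y\<close>] .
  \<comment> \<open>This is the inverse of the new structure. As \<open>\<sigma>\<^sub>0\<close>
    enters the boundary permutation through its inverse, right multiplication changes the cycle on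
    \<open>v\<close> and \<open>?\<phi>\<close> by the same transpositions.\<close>
  let ?\<tau> = "inv \<sigma>\<^sub>0 \<circ> transpose x y \<circ> transpose z w"
  have "w \<in> v" using w x y by auto
  have \<tau>: "?\<tau> permutes E"
    using perm x y z \<open>w \<in> v\<close> \<open>v \<subseteq> E\<close>
    by (intro permutes_compose permutes_swap_id permutes_inv) auto
  then have perm_\<tau>: "permutation ?\<tau>"
    using finite_edges permutation_permutes by blast
  have "cyclic_on ?\<tau> u" if u: "u \<in> vertices E R" for u
  proof (cases "u = v")
    case True
    then show ?thesis using cyc_v by simp
  next
    case False
    then have "u \<inter> v = {}"
      using u assms(4) quotient_disj[OF equiv_edges] unfolding vertices_def by blast
    then have "?\<tau> s = inv \<sigma>\<^sub>0 s" if "s \<in> u" for s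
      using that x y z \<open>w \<in> v\<close> by (auto simp: transpose_def)
    then show ?thesis using cyc_inv[OF u] cyclic_cong by metis
  qed
  then have "cyclic_on (inv ?\<tau>) u" if "u \<in> vertices E R" for u
    using that unfolding cyclic_on_def orbit_inv_eq[OF perm_\<tau>] by blast
  then have "fat_graph_structure E R (inv ?\<tau>)"
    unfolding fat_graph_structure_def using permutes_inv[OF \<tau>] by blast
  \<comment> \<open>The double inverse cancels, and reassociation turns
    \<open>\<sigma>\<^sub>1 \<circ> ?\<tau>\<close> into \<open>?\<phi>\<close> followed on the
    right by the two transpositions.\<close>
  moreover have "num_boundary E \<sigma>\<^sub>1 (inv ?\<tau>) + 2 = num_boundary E \<sigma>\<^sub>1 \<sigma>\<^sub>0"
    using card_orbits_comp_two_transposes[OF finite_edges \<phi> _ _ _ distinct w] x y z \<open>v \<subseteq> E\<close>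
    unfolding num_boundary_def boundary_components_def permutes_inv_inv[OF \<tau>]
    by (auto simp: comp_assoc)
  ultimately show ?thesis by force
qed

end
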